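(* Let $\Omega\subseteq\mathbb{R}^n$ be open and let $u\in C^2(\Omega,\mathbb{R}^N)$ be such that $|Du|$ has no local minima in $\Omega$. For each nonempty open $\Omega'\Subset\Omega$ put $$\Omega'(u):=\Big\{x\in\overline{\Omega'}\ :\ |Du(x)|=\|Du\|_{L^\infty(\Omega')}\Big\}.$$ Let $\mathcal{A}^{\top,\infty}_{\Omega'}(u)$ be the set of all affine maps $A:\mathbb{R}^n\to\mathbb{R}^N$ for which there exist $\xi\in\mathbb{R}^N$ and $x\in\Omega'(u)$ such that $A$ is parallel to the tangent of $\xi|Du|^2$ at $x$, i.e. $DA\equiv D\big(\xi|Du|^2\big)(x)$. Let $\mathcal{A}^{\bot,\infty}_{\Omega'}(u)$ be the set of all affine maps $A:\mathbb{R}^n\to\mathbb{R}^N$ for which there exists $x\in\Omega'(u)$ such that $A$ is normal to $Du$ at $x$, i.e. $A(x)^\top Du(x)=0$, and $A^\top Du$ is divergenceless at $x$, i.e. $\operatorname{div}\big(A^\top Du\big)(x)=0$. Then $\Delta_\infty u=0$ on $\Omega$ if and only if for all nonempty open $\Omega'\Subset\Omega$ and all $A\in\mathcal{A}^{\top,\infty}_{\Omega'}(u)\cup\mathcal{A}^{\bot,\infty}_{\Omega'}(u)$, $$\|Du\|_{L^\infty(\Omega')}\leq\|Du+DA\|_{L^\infty(\Omega')}.$$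
   Context: $Du=(D_iu_\alpha)$ is the $N\times n$ gradient matrix, $|\cdot|$ the Euclidean norm, $\Omega'\Subset\Omega$ means that $\overline{\Omega'}$ is compact and contained in $\Omega$, and $\|Du\|_{L^\infty(\Omega')}=\operatorname{ess\,sup}_{\Omega'}|Du|$. The $\infty$-Laplacian of $u$ is $$(\Delta_\infty u)_\alpha:=\sum_{\beta=1}^N\sum_{i,j=1}^n\Big(D_iu_\alpha\,D_ju_\beta+|Du|^2[Du]^\bot_{\alpha\beta}\,\delta_{ij}\Big)D^2_{ij}u_\beta,\qquad\alpha=1,\dots,N,$$ where $[Du(x)]^\bot$ is the orthogonal projection of $\mathbb{R}^N$ onto the orthogonal complement of the range $R(Du(x))$ of $Du(x):\mathbb{R}^n\to\mathbb{R}^N$. Here $A^\top Du$ is the $\mathbb{R}^n$-valued field with components $\sum_\alpha A_\alpha D_iu_\alpha$, and $D(\xi|Du|^2)(x)$ is the $N\times n$ matrix with entries $\xi_\alpha D_i(|Du|^2)(x)$. *)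

theory Defs
  imports "HOL-Analysis.Analysis" "HOL-Probability.Essential_Supremum"
begin

(* Row \<alpha>, column i of the gradient matrix is D_i u_\<alpha>.  The library norm on
   real ^ 'n ^ 'N is the Euclidean (Frobenius) norm of the matrix. *)
abbreviation Grad :: "(real ^ 'n \<Rightarrow> real ^ 'N) \<Rightarrow> real ^ 'n \<Rightarrow> real ^ 'n ^ 'N"
  where "Grad u x \<equiv> jacobian u (at x)"

definition partial :: "'n::finite \<Rightarrow> (real ^ 'n \<Rightarrow> real) \<Rightarrow> real ^ 'n \<Rightarrow> real"
  where "partial i f x = frechet_derivative f (at x) (axis i 1)"

definition partial2 :: "'n::finite \<Rightarrow> 'n \<Rightarrow> (real ^ 'n \<Rightarrow> real) \<Rightarrow> real ^ 'n \<Rightarrow> real"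
  where "partial2 i j f = partial i (partial j f)"

definition divergence :: "(real ^ 'n \<Rightarrow> real ^ 'n) \<Rightarrow> real ^ 'n \<Rightarrow> real"
  where "divergence F x = (\<Sum>i\<in>UNIV. partial i (\<lambda>y. F y $ i) x)"

(* Functions on an open set U are total functions of which only the values on U matter. *)
definition C2_on :: "(real ^ 'n) set \<Rightarrow> (real ^ 'n \<Rightarrow> real ^ 'N) \<Rightarrow> bool"
  where "C2_on U u \<longleftrightarrow>
    (\<forall>x\<in>U. u differentiable (at x)) \<and>
    (\<forall>x\<in>U. Grad u differentiable (at x)) \<and>
    (\<forall>i j \<beta>. continuous_on U (partial2 i j (\<lambda>y. u y $ \<beta>)))"

definition no_local_minima :: "(real ^ 'n) set \<Rightarrow> (real ^ 'n \<Rightarrow> real) \<Rightarrow> bool"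
  where "no_local_minima U f \<longleftrightarrow> \<not> (\<exists>x\<in>U. \<forall>\<^sub>F y in at x within U. f x \<le> f y)"

definition compactly_contained :: "'a::topological_space set \<Rightarrow> 'a set \<Rightarrow> bool" (infix \<open>\<Subset>\<close> 50)
  where "V \<Subset> U \<longleftrightarrow> compact (closure V) \<and> closure V \<subseteq> U"

definition Linf_norm :: "(real ^ 'n) set \<Rightarrow> (real ^ 'n \<Rightarrow> real ^ 'n ^ 'N) \<Rightarrow> ereal"
  where "Linf_norm V F = esssup (lebesgue_on V) (\<lambda>x. ereal (norm (F x)))"

definition orth_proj :: "'a::euclidean_space set \<Rightarrow> 'a \<Rightarrow> 'a"
  where "orth_proj S v = (THE p. p \<in> S \<and> v - p \<in> S\<^sup>\<bottom>)"

lemma orth_proj_unique_existence: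
  fixes S :: "'a::euclidean_space set"
  assumes "subspace S"
  shows "\<exists>!p. p \<in> S \<and> v - p \<in> S\<^sup>\<bottom>"
proof (rule ex_ex1I)
  obtain y z where "y \<in> span S" "\<And>w. w \<in> span S \<Longrightarrow> orthogonal z w" "v = y + z"
    using orthogonal_subspace_decomp_exists[of S v] by blast
  then have "y \<in> S \<and> v - y \<in> S\<^sup>\<bottom>"
    using assms by (auto simp: orthogonal_comp_def orthogonal_commute span_eq_iff[THEN iffD2])
  then show "\<exists>p. p \<in> S \<and> v - p \<in> S\<^sup>\<bottom>" by blast
next
  fix p q
  assume p: "p \<in> S \<and> v - p \<in> S\<^sup>\<bottom>" and q: "q \<in> S \<and> v - q \<in> S\<^sup>\<bottom>"
  have "p - q \<in> S"
    using p q assms by (simp add: subspace_diff)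
  then have "(p - q) \<bullet> (v - p) = 0" "(p - q) \<bullet> (v - q) = 0"
    using p q by (auto simp: orthogonal_comp_def orthogonal_def)
  then have "(p - q) \<bullet> (p - q) = 0"
    by (simp add: inner_diff_right)
  then show "p = q" by simp
qed

(* The matrix of the orthogonal projection onto the orthogonal complement of the range of M. *)
definition perp_matrix :: "real ^ 'n ^ 'N \<Rightarrow> real ^ 'N ^ 'N"
  where "perp_matrix M = matrix (orth_proj ((range (\<lambda>v. M *v v))\<^sup>\<bottom>))"

definition inf_laplacian :: "(real ^ 'n \<Rightarrow> real ^ 'N) \<Rightarrow> real ^ 'n \<Rightarrow> real ^ 'N"
  where "inf_laplacian u x = (\<chi> \<alpha>. \<Sum>\<beta>\<in>UNIV. \<Sum>i\<in>UNIV. \<Sum>j\<in>UNIV.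
    (Grad u x $ \<alpha> $ i * Grad u x $ \<beta> $ j
      + (norm (Grad u x))\<^sup>2 * perp_matrix (Grad u x) $ \<alpha> $ \<beta> * of_bool (i = j))
    * partial2 i j (\<lambda>y. u y $ \<beta>) x)"

definition affine_map :: "(real ^ 'n \<Rightarrow> real ^ 'N) \<Rightarrow> bool"
  where "affine_map A \<longleftrightarrow> (\<exists>M b. A = (\<lambda>x. M *v x + b))"

definition max_set :: "(real ^ 'n \<Rightarrow> real ^ 'N) \<Rightarrow> (real ^ 'n) set \<Rightarrow> (real ^ 'n) set"
  where "max_set u V = {x \<in> closure V. ereal (norm (Grad u x)) = Linf_norm V (Grad u)}"

definition tangential_affine ::
    "(real ^ 'n \<Rightarrow> real ^ 'N) \<Rightarrow> (real ^ 'n) set \<Rightarrow> (real ^ 'n \<Rightarrow> real ^ 'N) set"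
  where "tangential_affine u V = {A. affine_map A \<and>
    (\<exists>\<xi>. \<exists>x\<in>max_set u V. \<forall>y.
      Grad A y = (\<chi> \<alpha> i. \<xi> $ \<alpha> * partial i (\<lambda>z. (norm (Grad u z))\<^sup>2) x))}"

definition normal_affine ::
    "(real ^ 'n \<Rightarrow> real ^ 'N) \<Rightarrow> (real ^ 'n) set \<Rightarrow> (real ^ 'n \<Rightarrow> real ^ 'N) set"
  where "normal_affine u V = {A. affine_map A \<and>
    (\<exists>x\<in>max_set u V. A x v* Grad u x = 0 \<and> divergence (\<lambda>y. A y v* Grad u y) x = 0)}"

end

(* Writing P = Du(x), the infinity-Laplacian at x splits into the orthogonal parts
   (1/2) P (D|Du|^2)(x), in the range of P, and |P|^2 [P]^\<bottom> (Laplacian of u)(x), normal to it.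
   For an affine A with DA = M one has div (A^T Du)(x) = M : P + A(x) . (Laplacian of u)(x), so the
   vanishing of both parts says exactly that M : P = 0 for every admissible M, i.e. that
   |P| <= |P + t M| for all t.  At a point x of max_set this pointwise inequality implies the
   L-infinity one by continuity up to the boundary.  Conversely, since |Du| has no local minima,
   the sublevel sets {|Du| < |Du(x)|} intersected with small balls about x are nonempty and have x
   in their max_set, so shrinking the ball recovers the pointwise inequality. *)

theory Submission
  imports Defs
begin

section \<open>Derivative quantities and a variational criterion for orthogonality\<close>

definition grad_norm2 :: "(real ^ 'n \<Rightarrow> real ^ 'N) \<Rightarrow> real ^ 'n \<Rightarrow> real ^ 'n"
  where "grad_norm2 u x = (\<chi> i. partial i (\<lambda>z. (norm (Grad u z))\<^sup>2) x)"

definition laplacian :: "(real ^ 'n \<Rightarrow> real ^ 'N) \<Rightarrow> real ^ 'n \<Rightarrow> real ^ 'N"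
  where "laplacian u x = (\<chi> \<beta>. \<Sum>i\<in>UNIV. partial2 i i (\<lambda>y. u y $ \<beta>) x)"

text \<open>The quadratic |P + t M|^2 in t has its minimum at t = 0, so its linear coefficient
  vanishes. This turns norm inequalities along a line of matrices into an orthogonality
  relation.\<close>

lemma inner_eq_0_if_norm_le_add_scaleR:
  fixes P M :: "'a::real_inner"
  assumes "\<And>t. norm P \<le> norm (P + t *\<^sub>R M)"
  shows "P \<bullet> M = 0"
proof (cases "M = 0")
  case False
  define a where "a = P \<bullet> M"
  define m where "m = M \<bullet> M"
  \<comment> \<open>The vertex of the quadratic |P|^2 + 2 a t + m t^2, whose value there is |P|^2 -
    a^2 / m.\<close>
  define t where "t = - (a / m)"
  have m: "m > 0" using False by (simp add: m_def)
  have "P \<bullet> P \<le> (P + t *\<^sub>R M) \<bullet> (P + t *\<^sub>R M)"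
    using assms[of t] by (simp add: norm_le)
  also have "\<dots> = P \<bullet> P + 2 * t * a + t * t * m"
    by (simp add: a_def m_def algebra_simps inner_commute)
  also have "\<dots> = P \<bullet> P - a * a / m"
    using m by (simp add: t_def field_simps)
  finally have "a * a \<le> 0" using m by (simp add: divide_le_0_iff)
  then show ?thesis unfolding a_def by (metis antisym mult_eq_0_iff zero_le_square)
qed simp

lemma norm_le_norm_add_if_inner_eq_0:
  fixes P M :: "'a::real_inner"
  assumes "P \<bullet> M = 0"
  shows "norm P \<le> norm (P + M)"
  using assms by (simp add: norm_le algebra_simps inner_commute)

lemma inner_matrix: "(A :: real ^ 'n ^ 'm) \<bullet> B = (\<Sum>\<beta>\<in>UNIV. \<Sum>j\<in>UNIV. A $ \<beta> $ j * B $ \<beta> $ j)"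
  by (simp add: inner_vec_def)

section \<open>Essential suprema of continuous matrix fields\<close>

text \<open>A value above the essential supremum would persist on a neighbourhood of x. That
  neighbourhood meets V in a nonempty open set, which cannot be null. Continuity on W rather than
  only on V is what admits boundary points of V.\<close>

lemma norm_le_Linf_norm:
  assumes V: "open V" and W: "open W" and F: "continuous_on W F"
    and x: "x \<in> closure V" "x \<in> W"
  shows "ereal (norm (F x)) \<le> Linf_norm V F"
proof (rule ccontr)
  define e where "e = Linf_norm V F"
  define O' where "O' = {y \<in> W. e < ereal (norm (F y))}"
  assume "\<not> ?thesis"
  then have "x \<in> O'" using x by (simp add: O'_def e_def)
  have "continuous_on W (\<lambda>y. ereal (norm (F y)))"
    by (intro continuous_intros F)
  then have "open ((\<lambda>y. ereal (norm (F y))) -` {e<..} \<inter> W)"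
    using W continuous_on_open_vimage open_greaterThan by blast
  then have "open O'" by (simp add: O'_def vimage_def Int_def conj_commute)
  then have "O' \<inter> V \<noteq> {}"
    using \<open>x \<in> O'\<close> x(1) open_Int_closure_eq_empty by blast
  have "AE y in lebesgue_on V. ereal (norm (F y)) \<le> e"
    unfolding e_def Linf_norm_def by (rule esssup_AE)
  then have "AE y in lebesgue. y \<in> V \<longrightarrow> ereal (norm (F y)) \<le> e"
    using V by (subst (asm) AE_restrict_space_iff) auto
  then have "AE y in lebesgue. y \<notin> O' \<inter> V"
    by eventually_elim (auto simp: O'_def)
  then have "negligible (O' \<inter> V)"
    by (simp add: AE_iff_null_sets negligible_iff_null_sets \<open>open O'\<close> V open_Int)
  with \<open>open O'\<close> V \<open>O' \<inter> V \<noteq> {}\<close> show False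
    using open_not_negligible by blast
qed

lemma Linf_norm_le:
  assumes "open V" and "continuous_on V F" and "\<And>y. y \<in> V \<Longrightarrow> norm (F y) \<le> c"
  shows "Linf_norm V F \<le> ereal c"
  unfolding Linf_norm_def
proof (rule esssup_I)
  \<comment> \<open>Continuity supplies the measurability demanded when bounding
    \<open>esssup\<close> from above.\<close>
  have "(\<lambda>y. norm (F y)) \<in> borel_measurable (lebesgue_on V)"
    using assms by (intro continuous_imp_measurable_on_sets_lebesgue continuous_intros) auto
  then show "(\<lambda>y. ereal (norm (F y))) \<in> borel_measurable (lebesgue_on V)"
    by measurable
  show "AE y in lebesgue_on V. ereal (norm (F y)) \<le> ereal c"
    using assms by (intro AE_I2) auto
qed

section \<open>Partial derivatives, affine maps and pointwise formulas for C^2 maps\<close>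

lemma partial_eq: "(f has_derivative f') (at x) \<Longrightarrow> partial i f x = f' (axis i 1)"
  unfolding partial_def using frechet_derivative_at by metis

lemma partial_component:
  assumes "u differentiable (at x)"
  shows "partial j (\<lambda>y. u y $ \<beta>) x = Grad u x $ \<beta> $ j"
proof -
  have "(u has_derivative (\<lambda>h. Grad u x *v h)) (at x)"
    using assms jacobian_works by blast
  then have "((\<lambda>y. u y $ \<beta>) has_derivative (\<lambda>h. (Grad u x *v h) $ \<beta>)) (at x)"
    by (rule bounded_linear.has_derivative[OF bounded_linear_vec_nth])
  then show ?thesis
    by (simp add: partial_eq matrix_vector_mul_component inner_axis)
qed

lemma Grad_affine: "Grad (\<lambda>x. M *v x + b) y = M"
proof -
  have "((\<lambda>x. M *v x + b) has_derivative (\<lambda>h. M *v h)) (at y)"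
    by (auto intro!: derivative_eq_intros bounded_linear.has_derivative[OF matrix_vector_mul_bounded_linear])
  then have "frechet_derivative (\<lambda>x. M *v x + b) (at y) = (\<lambda>h. M *v h)"
    using frechet_derivative_at by metis
  then show ?thesis by (simp add: jacobian_def)
qed

lemma continuous_on_Grad: "C2_on \<Omega> u \<Longrightarrow> continuous_on \<Omega> (Grad u)"
  unfolding C2_on_def
  by (metis continuous_at_imp_continuous_on differentiable_imp_continuous_within)

context
  fixes \<Omega> :: "(real ^ 'n) set" and u :: "real ^ 'n \<Rightarrow> real ^ 'N" and x
  assumes \<Omega>: "open \<Omega>" and u: "C2_on \<Omega> u" and x: "x \<in> \<Omega>"
begin

lemma Grad_has_derivative:
  "(Grad u has_derivative frechet_derivative (Grad u) (at x)) (at x)"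
  using u x unfolding C2_on_def by (simp add: frechet_derivative_works)

lemma partial2_component:
  "partial2 i j (\<lambda>y. u y $ \<beta>) x = frechet_derivative (Grad u) (at x) (axis i 1) $ \<beta> $ j"
proof -
  have "((\<lambda>y. Grad u y $ \<beta> $ j) has_derivative
      (\<lambda>h. frechet_derivative (Grad u) (at x) h $ \<beta> $ j)) (at x)"
    by (intro bounded_linear.has_derivative[OF bounded_linear_vec_nth] Grad_has_derivative)
  \<comment> \<open>The inner partial agrees with the Jacobian entry only on \<Omega>; since
    \<Omega> is open, this suffices for transferring the derivative at x.\<close>
  then have "(partial j (\<lambda>y. u y $ \<beta>) has_derivative
      (\<lambda>h. frechet_derivative (Grad u) (at x) h $ \<beta> $ j)) (at x)"
    by (rule has_derivative_transform_within_open[OF _ \<Omega> x])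
       (use u in \<open>simp add: C2_on_def partial_component\<close>)
  then show ?thesis unfolding partial2_def by (rule partial_eq)
qed

lemma grad_norm2_component:
  "grad_norm2 u x $ i
    = 2 * (\<Sum>\<beta>\<in>UNIV. \<Sum>j\<in>UNIV. Grad u x $ \<beta> $ j * partial2 i j (\<lambda>y. u y $ \<beta>) x)"
proof -
  have "((\<lambda>z. Grad u z \<bullet> Grad u z) has_derivative
      (\<lambda>h. Grad u x \<bullet> frechet_derivative (Grad u) (at x) h
        + frechet_derivative (Grad u) (at x) h \<bullet> Grad u x)) (at x)"
    by (intro has_derivative_inner Grad_has_derivative)
  then show ?thesis
    unfolding grad_norm2_def power2_norm_eq_inner
    by (simp add: partial_eq inner_commute partial2_component flip: inner_matrix)
qed

text \<open>Product rule: differentiating the affine factor yields the matrix pairing with M, and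
  differentiating \<open>Grad u\<close> yields the trace of each component's Hessian, weighted by
  the affine map's value at x.\<close>

lemma divergence_affine_Grad:
  "divergence (\<lambda>y. (M *v y + b) v* Grad u y) x
    = M \<bullet> Grad u x + (M *v x + b) \<bullet> laplacian u x"
proof -
  let ?D = "frechet_derivative (Grad u) (at x)"
  have "partial i (\<lambda>y. ((M *v y + b) v* Grad u y) $ i) x
      = (\<Sum>\<alpha>\<in>UNIV. M $ \<alpha> $ i * Grad u x $ \<alpha> $ i + (M *v x + b) $ \<alpha> * ?D (axis i 1) $ \<alpha> $ i)" for i
  proof -
    have D: "((\<lambda>y. Grad u y $ \<alpha> $ i) has_derivative (\<lambda>h. ?D h $ \<alpha> $ i)) (at x)" for \<alpha>
      by (intro bounded_linear.has_derivative[OF bounded_linear_vec_nth] Grad_has_derivative)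
    have A: "((\<lambda>y. (M *v y + b) $ \<alpha>) has_derivative (\<lambda>h. (M *v h) $ \<alpha>)) (at x)" for \<alpha>
      by (rule bounded_linear.has_derivative[OF bounded_linear_vec_nth])
         (auto intro!: derivative_eq_intros
           bounded_linear.has_derivative[OF matrix_vector_mul_bounded_linear])
    have "((\<lambda>y. \<Sum>\<alpha>\<in>UNIV. (M *v y + b) $ \<alpha> * Grad u y $ \<alpha> $ i) has_derivative
        (\<lambda>h. \<Sum>\<alpha>\<in>UNIV. (M *v x + b) $ \<alpha> * ?D h $ \<alpha> $ i + (M *v h) $ \<alpha> * Grad u x $ \<alpha> $ i)) (at x)"
      by (intro has_derivative_sum has_derivative_mult A D)
    moreover have "((M *v y + b) v* Grad u y) $ i
        = (\<Sum>\<alpha>\<in>UNIV. (M *v y + b) $ \<alpha> * Grad u y $ \<alpha> $ i)" for y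
      by (simp add: vector_matrix_mult_def mult.commute)
    ultimately show ?thesis
      by (simp add: partial_eq matrix_vector_mul_component inner_axis add.commute
          del: vector_add_component)
  qed
  then have "divergence (\<lambda>y. (M *v y + b) v* Grad u y) x
      = (\<Sum>i\<in>UNIV. \<Sum>\<alpha>\<in>UNIV. M $ \<alpha> $ i * Grad u x $ \<alpha> $ i
          + (M *v x + b) $ \<alpha> * ?D (axis i 1) $ \<alpha> $ i)"
    by (simp add: divergence_def)
  also have "\<dots> = (\<Sum>\<alpha>\<in>UNIV. \<Sum>i\<in>UNIV. M $ \<alpha> $ i * Grad u x $ \<alpha> $ i
          + (M *v x + b) $ \<alpha> * ?D (axis i 1) $ \<alpha> $ i)"
    by (rule sum.swap)
  also have "\<dots> = M \<bullet> Grad u x + (M *v x + b) \<bullet> laplacian u x"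
    unfolding inner_matrix laplacian_def inner_vec_def[of "M *v x + b"]
    by (simp add: sum.distrib sum_distrib_left partial2_component del: vector_add_component)
  finally show ?thesis .
qed

lemma inf_laplacian_eq:
  "inf_laplacian u x = Grad u x *v ((1/2) *\<^sub>R grad_norm2 u x)
    + (norm (Grad u x))\<^sup>2 *\<^sub>R (perp_matrix (Grad u x) *v laplacian u x)"
proof -
  let ?P = "Grad u x" and ?c = "(norm (Grad u x))\<^sup>2" and ?Q = "perp_matrix (Grad u x)"
  let ?d = "\<lambda>i j \<beta>. partial2 i j (\<lambda>y. u y $ \<beta>) x"
  have "(\<Sum>\<beta>\<in>UNIV. \<Sum>i\<in>UNIV. \<Sum>j\<in>UNIV.
        (?P $ \<alpha> $ i * ?P $ \<beta> $ j + ?c * ?Q $ \<alpha> $ \<beta> * of_bool (i = j)) * ?d i j \<beta>)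
      = (\<Sum>i\<in>UNIV. ?P $ \<alpha> $ i * (\<Sum>\<beta>\<in>UNIV. \<Sum>j\<in>UNIV. ?P $ \<beta> $ j * ?d i j \<beta>))
        + ?c * (\<Sum>\<beta>\<in>UNIV. ?Q $ \<alpha> $ \<beta> * (\<Sum>i\<in>UNIV. ?d i i \<beta>))" for \<alpha>
  proof -
    \<comment> \<open>The Kronecker factor collapses the j-sum of the second term to j = i.\<close>
    have "(\<Sum>\<beta>\<in>UNIV. \<Sum>i\<in>UNIV. \<Sum>j\<in>UNIV.
        (?P $ \<alpha> $ i * ?P $ \<beta> $ j + ?c * ?Q $ \<alpha> $ \<beta> * of_bool (i = j)) * ?d i j \<beta>)
      = (\<Sum>\<beta>\<in>UNIV. \<Sum>i\<in>UNIV. ?P $ \<alpha> $ i * (\<Sum>j\<in>UNIV. ?P $ \<beta> $ j * ?d i j \<beta>))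
        + (\<Sum>\<beta>\<in>UNIV. \<Sum>i\<in>UNIV. ?c * ?Q $ \<alpha> $ \<beta> * ?d i i \<beta>)"
      by (simp add: distrib_right sum.distrib sum_distrib_left mult.assoc of_bool_def
          if_distrib[of "\<lambda>a. a * _"] if_distrib[of "(*) _"] cong: if_cong)
    \<comment> \<open>With i outermost, the inner double sum is half the i-th component of
      \<open>grad_norm2 u x\<close>.\<close>
    also have "(\<Sum>\<beta>\<in>UNIV. \<Sum>i\<in>UNIV. ?P $ \<alpha> $ i * (\<Sum>j\<in>UNIV. ?P $ \<beta> $ j * ?d i j \<beta>))
      = (\<Sum>i\<in>UNIV. ?P $ \<alpha> $ i * (\<Sum>\<beta>\<in>UNIV. \<Sum>j\<in>UNIV. ?P $ \<beta> $ j * ?d i j \<beta>))"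
      by (subst sum.swap) (simp add: sum_distrib_left)
    finally show ?thesis by (simp add: sum_distrib_left mult.assoc)
  qed
  then show ?thesis
    by (simp add: inf_laplacian_def vec_eq_iff matrix_vector_mult_def grad_norm2_component
        laplacian_def)
qed

end

section \<open>Orthogonal projection and the two parts of the infinity-Laplacian\<close>

lemma orth_proj_props:
  fixes S :: "'a::euclidean_space set"
  assumes "subspace S"
  shows "orth_proj S v \<in> S" and "v - orth_proj S v \<in> S\<^sup>\<bottom>"
  using theI'[OF orth_proj_unique_existence[OF assms, of v]] unfolding orth_proj_def by auto

lemma orth_proj_eqI:
  fixes S :: "'a::euclidean_space set"
  assumes "subspace S" "p \<in> S" "v - p \<in> S\<^sup>\<bottom>"
  shows "orth_proj S v = p"
  using orth_proj_unique_existence[OF assms(1), of v] orth_proj_props[OF assms(1), of v] assms(2,3)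
  by blast

text \<open>Sums and multiples of projections satisfy the conditions that characterize the
  projection uniquely. Linearity is what lets \<open>perp_matrix\<close> act as the
  projection.\<close>

lemma linear_orth_proj:
  fixes S :: "'a::euclidean_space set"
  assumes S: "subspace S"
  shows "linear (orth_proj S)"
proof (rule linearI)
  note p = orth_proj_props[OF S] and T = subspace_orthogonal_comp[of S]
  show "orth_proj S (v + w) = orth_proj S v + orth_proj S w" for v w
    using subspace_add[OF S p(1) p(1), of v w] subspace_add[OF T p(2) p(2), of v w]
    by (intro orth_proj_eqI[OF S]) (simp_all add: algebra_simps)
  show "orth_proj S (c *\<^sub>R v) = c *\<^sub>R orth_proj S v" for c v
    using subspace_scale[OF S p(1), of c v] subspace_scale[OF T p(2), of c v]
    by (intro orth_proj_eqI[OF S]) (simp_all add: algebra_simps)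
qed

text \<open>Moving P across the inner product turns orthogonality to every P h into the condition
  used in \<open>normal_affine\<close>.\<close>

lemma mem_orthogonal_comp_range_matrix:
  fixes P :: "real ^ 'n ^ 'N"
  shows "v \<in> (range (\<lambda>h. P *v h))\<^sup>\<bottom> \<longleftrightarrow> v v* P = 0"
proof -
  have "v \<in> (range (\<lambda>h. P *v h))\<^sup>\<bottom> \<longleftrightarrow> (\<forall>h. (v v* P) \<bullet> h = 0)"
    by (auto simp: orthogonal_comp_def orthogonal_def dot_lmul_matrix inner_commute[of "P *v _"])
  also have "\<dots> \<longleftrightarrow> v v* P = 0" by (metis inner_eq_zero_iff inner_zero_left)
  finally show ?thesis .
qed

text \<open>The projection removes from w only a vector orthogonal to the normal space, which
  pairing with a normal v does not detect.\<close>

lemma perp_matrix_props: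
  fixes P :: "real ^ 'n ^ 'N"
  shows "(perp_matrix P *v w) v* P = 0"
    and "v v* P = 0 \<Longrightarrow> v \<bullet> (perp_matrix P *v w) = v \<bullet> w"
proof -
  let ?S = "(range (\<lambda>h. P *v h))\<^sup>\<bottom>"
  have S: "subspace ?S" by (rule subspace_orthogonal_comp)
  have eq: "perp_matrix P *v w = orth_proj ?S w"
    unfolding perp_matrix_def using matrix_vector_mul(2)[OF linear_orth_proj[OF S]] by metis
  show "(perp_matrix P *v w) v* P = 0"
    unfolding eq using orth_proj_props(1)[OF S] mem_orthogonal_comp_range_matrix by blast
  assume "v v* P = 0"
  then have "v \<in> ?S" by (simp add: mem_orthogonal_comp_range_matrix)
  with orth_proj_props(2)[OF S, of w] have "v \<bullet> (w - orth_proj ?S w) = 0"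
    by (auto simp: orthogonal_comp_def orthogonal_def)
  then show "v \<bullet> (perp_matrix P *v w) = v \<bullet> w"
    by (simp add: eq inner_diff_right)
qed

text \<open>The tangential part a and the normal part are orthogonal, so their sum vanishes only if
  both do. The factor |Du|^2 on the normal part explains the guard
  \<open>Grad u x \<noteq> 0\<close>.\<close>

lemma inf_laplacian_eq_0_iff:
  assumes "open \<Omega>" "C2_on \<Omega> u" "x \<in> \<Omega>"
  shows "inf_laplacian u x = 0 \<longleftrightarrow> Grad u x *v grad_norm2 u x = 0
    \<and> (Grad u x \<noteq> 0 \<longrightarrow> (\<forall>v. v v* Grad u x = 0 \<longrightarrow> v \<bullet> laplacian u x = 0))"
proof -
  let ?P = "Grad u x" and ?L = "laplacian u x"
  define a where "a = ?P *v ((1/2) *\<^sub>R grad_norm2 u x)"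
  define q where "q = perp_matrix ?P *v ?L"
  have a: "a = 0 \<longleftrightarrow> ?P *v grad_norm2 u x = 0"
    by (simp add: a_def matrix_vector_mult_scaleR)
  have ortho: "q \<bullet> a = 0"
    unfolding q_def a_def by (simp add: perp_matrix_props(1) flip: dot_lmul_matrix)
  have split: "a + c *\<^sub>R q = 0 \<longleftrightarrow> a = 0 \<and> c *\<^sub>R q = 0" for c
  proof
    assume "a + c *\<^sub>R q = 0"
    moreover have "(a + c *\<^sub>R q) \<bullet> a = a \<bullet> a" by (simp add: inner_add_left ortho)
    ultimately show "a = 0 \<and> c *\<^sub>R q = 0" by simp
  qed simp
  \<comment> \<open>q is itself a normal vector, so testing the Laplacian against v = q gives |q|^2;
    hence q = 0 can be checked through normal test vectors.\<close>
  have "q \<bullet> q = q \<bullet> ?L"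
    unfolding q_def by (rule perp_matrix_props(2)[OF perp_matrix_props(1)])
  then have q: "q = 0 \<longleftrightarrow> (\<forall>v. v v* ?P = 0 \<longrightarrow> v \<bullet> ?L = 0)"
    using perp_matrix_props(1)[of ?P ?L] perp_matrix_props(2)[of _ ?P ?L] unfolding q_def[symmetric]
    by (metis inner_eq_zero_iff inner_zero_right)
  have "inf_laplacian u x = a + (norm ?P)\<^sup>2 *\<^sub>R q"
    unfolding a_def q_def by (rule inf_laplacian_eq[OF assms])
  then show ?thesis
    unfolding a[symmetric] q[symmetric] by (auto simp: split)
qed

section \<open>Localization: from essential suprema to pointwise inequalities\<close>

text \<open>For a strict sublevel set of |Du| in a ball about x, the bound by |Du(x)| is built in.
  The reverse bound follows from \<open>norm_le_Linf_norm\<close> once x is a limit of the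
  set.\<close>

lemma obtain_max_set:
  fixes u :: "real ^ 'n \<Rightarrow> real ^ 'N"
  assumes \<Omega>: "open \<Omega>" and u: "C2_on \<Omega> u"
    and min: "no_local_minima \<Omega> (\<lambda>x. norm (Grad u x))"
    and x: "x \<in> \<Omega>" and W: "open W" "x \<in> W"
  obtains V where "open V" "V \<noteq> {}" "V \<Subset> \<Omega>" "V \<subseteq> W" "x \<in> max_set u V"
proof -
  let ?f = "\<lambda>y. norm (Grad u y)"
  have cont: "continuous_on \<Omega> ?f" by (intro continuous_intros continuous_on_Grad u)
  \<comment> \<open>A closed ball, so that the closure of \<open>?V\<close> also stays inside
    \<Omega>.\<close>
  obtain r where r: "r > 0" "cball x r \<subseteq> \<Omega> \<inter> W"
    using \<Omega> x W by (meson IntI open_Int open_contains_cball)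
  let ?V = "ball x r \<inter> {y. ?f y < ?f x}"
  have "open (?f -` {..<?f x} \<inter> \<Omega>)"
    using cont \<Omega> continuous_on_open_vimage open_lessThan by blast
  then have "open (ball x r \<inter> (?f -` {..<?f x} \<inter> \<Omega>))" by blast
  also have "ball x r \<inter> (?f -` {..<?f x} \<inter> \<Omega>) = ?V" using r by auto
  finally have V: "open ?V" .
  \<comment> \<open>Since x is not a local minimum, points with smaller |Du| occur arbitrarily near
    x; the radius \<open>min e r\<close> also keeps them in the ball.\<close>
  have "\<exists>y \<in> ?V. dist y x < e" if "e > 0" for e
  proof -
    have "\<not> (\<forall>\<^sub>F y in at x within \<Omega>. ?f x \<le> ?f y)"
      using min x unfolding no_local_minima_def by blast
    moreover have "min e r > 0" using that r(1) by simp
    ultimately obtain y where "y \<in> \<Omega>" "dist y x < min e r" "\<not> ?f x \<le> ?f y"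
      unfolding eventually_at by blast
    then have "y \<in> ?V" "dist y x < e" by (simp_all add: dist_commute[of x y])
    then show ?thesis ..
  qed
  then have xV: "x \<in> closure ?V" by (simp add: closure_approachable)
  then have ne: "?V \<noteq> {}" by (metis closure_empty empty_iff)
  have cl: "closure ?V \<subseteq> cball x r" by (rule closure_minimal) auto
  moreover have "bounded (closure ?V)" by (rule bounded_subset[OF bounded_cball cl])
  ultimately have comp: "?V \<Subset> \<Omega>"
    unfolding compactly_contained_def using r(2) by (simp add: compact_eq_bounded_closed) blast
  have "Linf_norm ?V (Grad u) = ereal (?f x)"
  proof (rule antisym)
    show "ereal (?f x) \<le> Linf_norm ?V (Grad u)"
      by (rule norm_le_Linf_norm[OF V \<Omega> continuous_on_Grad[OF u] xV x])
    show "Linf_norm ?V (Grad u) \<le> ereal (?f x)"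
      using r by (intro Linf_norm_le[OF V continuous_on_subset[OF continuous_on_Grad[OF u]]]) auto
  qed
  with xV have "x \<in> max_set u ?V" by (simp add: max_set_def)
  moreover have "?V \<subseteq> W" using r(2) ball_subset_cball by blast
  ultimately show thesis using that[OF V ne comp] by blast
qed

lemma pointwise_norm_le:
  fixes u :: "real ^ 'n \<Rightarrow> real ^ 'N"
  assumes \<Omega>: "open \<Omega>" and u: "C2_on \<Omega> u"
    and min: "no_local_minima \<Omega> (\<lambda>x. norm (Grad u x))"
    and x: "x \<in> \<Omega>"
    and le: "\<And>V. open V \<Longrightarrow> V \<noteq> {} \<Longrightarrow> V \<Subset> \<Omega> \<Longrightarrow> x \<in> max_set u V \<Longrightarrow>
      Linf_norm V (Grad u) \<le> Linf_norm V (\<lambda>y. Grad u y + M)"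
  shows "norm (Grad u x) \<le> norm (Grad u x + M)"
proof (rule ccontr)
  let ?F = "\<lambda>y. Grad u y + M"
  assume "\<not> ?thesis"
  \<comment> \<open>The bound \<open>c\<close> holds on a whole neighbourhood of x, and the gap
    \<open>c < norm (Grad u x)\<close> remains strict although the essential supremum over V is only
    known to be at most \<open>c\<close>.\<close>
  then obtain c where c: "norm (?F x) < c" "c < norm (Grad u x)"
    using dense[of "norm (?F x)" "norm (Grad u x)"] by auto
  have cont: "continuous_on \<Omega> ?F"
    by (intro continuous_intros continuous_on_Grad u)
  then have "continuous_on \<Omega> (\<lambda>y. norm (?F y))" by (rule continuous_on_norm)
  then have "open ((\<lambda>y. norm (?F y)) -` {..<c} \<inter> \<Omega>)"
    using \<Omega> continuous_on_open_vimage open_lessThan by blast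
  moreover have "x \<in> (\<lambda>y. norm (?F y)) -` {..<c} \<inter> \<Omega>" using c(1) x by simp
  ultimately obtain V where V: "open V" "V \<noteq> {}" "V \<Subset> \<Omega>" "x \<in> max_set u V"
      and sub: "V \<subseteq> (\<lambda>y. norm (?F y)) -` {..<c} \<inter> \<Omega>"
    by (rule obtain_max_set[OF \<Omega> u min x])
  have "ereal (norm (Grad u x)) = Linf_norm V (Grad u)"
    using V(4) by (simp add: max_set_def)
  also have "\<dots> \<le> Linf_norm V ?F" by (rule le[OF V])
  also have "\<dots> \<le> ereal c"
    using sub by (intro Linf_norm_le[OF V(1)] continuous_on_subset[OF cont]) (auto simp: less_imp_le)
  finally show False using c by simp
qed

text \<open>The matrix on the left is the outer product of \<xi> and \<open>grad_norm2 u x\<close>;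
  pairing it with Du therefore tests the tangential part of the infinity-Laplacian against
  \<xi>.\<close>

lemma inner_outer_grad_norm2:
  "Grad u x \<bullet> (\<chi> \<alpha> i. \<xi> $ \<alpha> * partial i (\<lambda>z. (norm (Grad u z))\<^sup>2) x)
    = \<xi> \<bullet> (Grad u x *v grad_norm2 u x)"
  by (simp add: inner_matrix inner_vec_def matrix_vector_mult_def grad_norm2_def
      sum_distrib_left algebra_simps)

section \<open>Equivalence of the equation and the affine minimality condition\<close>

theorem corollary13:
  fixes \<Omega> :: "(real ^ 'n) set" and u :: "real ^ 'n \<Rightarrow> real ^ 'N"
  assumes "open \<Omega>"
    and "C2_on \<Omega> u"
    and "no_local_minima \<Omega> (\<lambda>x. norm (Grad u x))"
  shows "(\<forall>x\<in>\<Omega>. inf_laplacian u x = 0) \<longleftrightarrow>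
    (\<forall>\<Omega>'. open \<Omega>' \<and> \<Omega>' \<noteq> {} \<and> \<Omega>' \<Subset> \<Omega> \<longrightarrow>
      (\<forall>A \<in> tangential_affine u \<Omega>' \<union> normal_affine u \<Omega>'.
        Linf_norm \<Omega>' (Grad u) \<le> Linf_norm \<Omega>' (\<lambda>x. Grad u x + Grad A x)))"
    (is "?harmonic \<longleftrightarrow> ?minimal")
proof
  assume harmonic: ?harmonic
  show ?minimal
  proof (intro allI impI ballI)
    fix V A
    assume V: "open V \<and> V \<noteq> {} \<and> V \<Subset> \<Omega>"
      and A: "A \<in> tangential_affine u V \<union> normal_affine u V"
    then obtain M b where Ab: "A = (\<lambda>x. M *v x + b)"
      by (auto simp: tangential_affine_def normal_affine_def affine_map_def)
    \<comment> \<open>Since \<open>Grad A\<close> is the constant M, both kinds of affine map become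
      conditions at one point x of the max set.\<close>
    obtain x where x: "x \<in> max_set u V" and A': "(\<exists>\<xi>. M = (\<chi> \<alpha> i. \<xi> $ \<alpha> * partial i (\<lambda>z. (norm (Grad u z))\<^sup>2) x))
        \<or> (A x v* Grad u x = 0 \<and> divergence (\<lambda>y. A y v* Grad u y) x = 0)"
      using A by (auto simp: tangential_affine_def normal_affine_def Ab Grad_affine)
    have xV: "x \<in> closure V" and Linf: "Linf_norm V (Grad u) = ereal (norm (Grad u x))"
      using x by (auto simp: max_set_def)
    with V have x\<Omega>: "x \<in> \<Omega>" by (auto simp: compactly_contained_def)
    note eq0 = harmonic[rule_format, OF x\<Omega>, unfolded inf_laplacian_eq_0_iff[OF assms(1,2) x\<Omega>]]
    have "Grad u x \<bullet> M = 0"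
      using A'
    proof (elim disjE exE conjE)
      fix \<xi> assume "M = (\<chi> \<alpha> i. \<xi> $ \<alpha> * partial i (\<lambda>z. (norm (Grad u z))\<^sup>2) x)"
      then show ?thesis using eq0 by (simp add: inner_outer_grad_norm2)
    next
      assume "A x v* Grad u x = 0" "divergence (\<lambda>y. A y v* Grad u y) x = 0"
      then show ?thesis
        using eq0 divergence_affine_Grad[OF assms(1,2) x\<Omega>, of M b]
        \<comment> \<open>If Du(x) = 0 the pairing is trivially zero; otherwise the normal equation
          kills A(x) paired with the Laplacian, and the divergence condition leaves only the pairing
          of M with Du(x).\<close>
        by (cases "Grad u x = 0") (auto simp: Ab inner_commute)
    qed
    then have "norm (Grad u x) \<le> norm (Grad u x + M)"
      by (rule norm_le_norm_add_if_inner_eq_0)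
    then have "Linf_norm V (Grad u) \<le> ereal (norm (Grad u x + M))"
      by (simp add: Linf)
    also have "\<dots> \<le> Linf_norm V (\<lambda>y. Grad u y + M)"
      using V by (intro norm_le_Linf_norm[OF _ assms(1) _ xV x\<Omega>] continuous_intros
          continuous_on_Grad assms) auto
    finally show "Linf_norm V (Grad u) \<le> Linf_norm V (\<lambda>x. Grad u x + Grad A x)"
      by (simp add: Ab Grad_affine)
  qed
next
  assume minimal: ?minimal
  show ?harmonic
  proof
    fix x assume x: "x \<in> \<Omega>"
    let ?P = "Grad u x" and ?L = "laplacian u x"
    \<comment> \<open>Membership in either class depends on V only through
      \<open>max_set u V\<close>, so one affine map can be admissible for every V whose max set
      contains x, as the localization requires.\<close>
    have le: "norm ?P \<le> norm (?P + M)"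
      if "\<And>V. x \<in> max_set u V \<Longrightarrow> (\<lambda>y. M *v y + b) \<in> tangential_affine u V \<union> normal_affine u V" for M b
    proof (rule pointwise_norm_le[OF assms x])
      fix V assume V: "open V" "V \<noteq> {}" "V \<Subset> \<Omega>" "x \<in> max_set u V"
      have "Linf_norm V (Grad u) \<le> Linf_norm V (\<lambda>z. Grad u z + Grad (\<lambda>y. M *v y + b) z)"
        by (rule minimal[rule_format]) (use V that in blast)+
      then show "Linf_norm V (Grad u) \<le> Linf_norm V (\<lambda>z. Grad u z + M)"
        by (simp only: Grad_affine)
    qed
    have "\<xi> \<bullet> (?P *v grad_norm2 u x) = 0" for \<xi>
    proof -
      let ?M = "\<chi> \<alpha> i. \<xi> $ \<alpha> * partial i (\<lambda>z. (norm (Grad u z))\<^sup>2) x"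
      have "norm ?P \<le> norm (?P + t *\<^sub>R ?M)" for t
      \<comment> \<open>Tangentiality constrains only the gradient, so offset 0 is chosen; the
        factor t is absorbed into \<xi>.\<close>
      proof (rule le[where b = 0])
        fix V assume "x \<in> max_set u V"
        moreover have "t *\<^sub>R ?M = (\<chi> \<alpha> i. (t *\<^sub>R \<xi>) $ \<alpha> * partial i (\<lambda>z. (norm (Grad u z))\<^sup>2) x)"
          by (simp add: vec_eq_iff)
        ultimately have "(\<lambda>y. t *\<^sub>R ?M *v y + 0) \<in> tangential_affine u V"
          unfolding tangential_affine_def affine_map_def Grad_affine mem_Collect_eq by blast
        then show "(\<lambda>y. t *\<^sub>R ?M *v y + 0) \<in> tangential_affine u V \<union> normal_affine u V" ..
      qed
      then have "?P \<bullet> ?M = 0" by (rule inner_eq_0_if_norm_le_add_scaleR)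
      then show ?thesis by (simp add: inner_outer_grad_norm2)
    qed
    then have "?P *v grad_norm2 u x = 0" by (metis inner_eq_zero_iff)
    moreover have "v \<bullet> ?L = 0" if P: "?P \<noteq> 0" and v: "v v* ?P = 0" for v
    proof -
      (* A(x) = v and DA = M, with M a multiple of Du(x) chosen so that A^T Du is divergenceless at x. *)
      define M where "M = (- (v \<bullet> ?L) / (?P \<bullet> ?P)) *\<^sub>R ?P"
      have MP: "M \<bullet> ?P = - (v \<bullet> ?L)" using P by (simp add: M_def)
      have "norm ?P \<le> norm (?P + t *\<^sub>R M)" for t
      \<comment> \<open>This offset gives the map the value t v at x. Normality and the divergence
        condition are linear in the affine map, so they survive scaling by t.\<close>
      proof (rule le[where b = "t *\<^sub>R v - t *\<^sub>R M *v x"])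
        let ?A = "\<lambda>y. t *\<^sub>R M *v y + (t *\<^sub>R v - t *\<^sub>R M *v x)"
        fix V assume "x \<in> max_set u V"
        moreover have "?A x v* ?P = 0" using v by (simp add: scaleR_vector_matrix_assoc)
        moreover have "divergence (\<lambda>y. ?A y v* Grad u y) x = 0"
          unfolding divergence_affine_Grad[OF assms(1,2) x] by (simp add: MP)
        ultimately have "?A \<in> normal_affine u V"
          unfolding normal_affine_def affine_map_def by blast
        then show "?A \<in> tangential_affine u V \<union> normal_affine u V" ..
      qed
      then have "?P \<bullet> M = 0" by (rule inner_eq_0_if_norm_le_add_scaleR)
      \<comment> \<open>The pairing of M with \<open>?P\<close> was arranged to be minus the
        quantity sought, so its vanishing is the claim.\<close>
      with MP show ?thesis by (simp add: inner_commute)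
    qed
    ultimately show "inf_laplacian u x = 0"
      by (simp add: inf_laplacian_eq_0_iff[OF assms(1,2) x])
  qed
qed

end
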